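(* Let $U$ be a unitary operator on a separable complex Hilbert space $\mathcal{H}$ such that $1$ is an accumulation point of its spectrum $\sigma(U)$. Let $L:=UP^U(\partial\mathbb{D}\setminus\{1\})$. If $L^j$ converges to zero in the weak operator topology as $j\to\infty$, then the set $\mathcal{G}(U)$ of all $\psi\in\mathcal{H}$ such that, for all $\epsilon>0$, $$\limsup_{K\to\infty}K^{\epsilon}\,\Big\|\frac1K\sum_{j=0}^{K-1}U^j\psi-\psi^*\Big\|^2=\infty$$ and $$\liminf_{K\to\infty}K^{2-\epsilon}\,\Big\|\frac1K\sum_{j=0}^{K-1}U^j\psi-\psi^*\Big\|^2=0,$$ is a dense $G_\delta$ set in $\mathcal{H}$.
   Context: Write $\partial\mathbb{D}=\{z\in\mathbb{C}: |z|=1\}$. $P^U$ denotes the resolution of the identity (projection-valued spectral measure on $\partial\mathbb{D}$) of $U$, and $\psi^*:=P^U(\{1\})\psi$, i.e. the orthogonal projection of $\psi$ onto $\{\varphi\in\mathcal{H}: U\varphi=\varphi\}$. Convergence of $L^j$ to zero in the weak operator topology means $\langle L^j\psi,\varphi\rangle\to0$ as $j\to\infty$ for all $\psi,\varphi\in\mathcal{H}$. $K$ ranges over the positive integers. *)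

theory Defs
  imports "HOL-Analysis.Analysis"
begin

section \<open>Complex Hilbert spaces\<close>

text \<open>A complex inner product is layered on top of the library class of real inner product spaces:
  the real inner product is required to be the real part of the complex one, so norm and topology
  are those induced by \<open>cinner\<close>. The complex inner product is linear in its first argument.\<close>

class complex_inner = real_inner +
  fixes scaleC :: "complex \<Rightarrow> 'a \<Rightarrow> 'a"  (infixr \<open>*\<^sub>C\<close> 75)
    and cinner :: "'a \<Rightarrow> 'a \<Rightarrow> complex"
  assumes scaleC_add_right: "a *\<^sub>C (x + y) = a *\<^sub>C x + a *\<^sub>C y"
    and scaleC_add_left: "(a + b) *\<^sub>C x = a *\<^sub>C x + b *\<^sub>C x"
    and scaleC_scaleC: "a *\<^sub>C (b *\<^sub>C x) = (a * b) *\<^sub>C x"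
    and scaleC_of_real: "complex_of_real r *\<^sub>C x = r *\<^sub>R x"
    and cinner_commute: "cinner x y = cnj (cinner y x)"
    and cinner_add_left: "cinner (x + y) z = cinner x z + cinner y z"
    and cinner_scaleC_left: "cinner (a *\<^sub>C x) y = a * cinner x y"
    and inner_eq_Re_cinner: "inner x y = Re (cinner x y)"

class complex_hilbert_space = complex_inner + complete_space

instantiation complex :: complex_hilbert_space
begin

definition scaleC_complex :: "complex \<Rightarrow> complex \<Rightarrow> complex"
  where "scaleC_complex a x = a * x"

definition cinner_complex :: "complex \<Rightarrow> complex \<Rightarrow> complex"
  where "cinner_complex x y = x * cnj y"

instance
  by standard (simp_all add: scaleC_complex_def cinner_complex_def algebra_simps
      scaleR_conv_of_real inner_complex_def)

end

section \<open>Operators\<close>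

definition bounded_clinear :: "('a::complex_inner \<Rightarrow> 'b::complex_inner) \<Rightarrow> bool"
  where "bounded_clinear T \<longleftrightarrow> bounded_linear T \<and> (\<forall>c x. T (c *\<^sub>C x) = c *\<^sub>C T x)"

definition unitary_operator :: "('a::complex_inner \<Rightarrow> 'a) \<Rightarrow> bool"
  where "unitary_operator U \<longleftrightarrow>
    bounded_clinear U \<and> surj U \<and> (\<forall>x y. cinner (U x) (U y) = cinner x y)"

definition orthogonal_projection :: "('a::complex_inner \<Rightarrow> 'a) \<Rightarrow> bool"
  where "orthogonal_projection Q \<longleftrightarrow>
    bounded_clinear Q \<and> Q \<circ> Q = Q \<and> (\<forall>x y. cinner (Q x) y = cinner x (Q y))"

definition resolvent_set :: "('a::complex_inner \<Rightarrow> 'a) \<Rightarrow> complex set"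
  where "resolvent_set T =
    {z. \<exists>R. bounded_clinear R \<and> (\<forall>x. R (T x - z *\<^sub>C x) = x) \<and> (\<forall>x. T (R x) - z *\<^sub>C R x = x)}"

definition op_spectrum :: "('a::complex_inner \<Rightarrow> 'a) \<Rightarrow> complex set"
  where "op_spectrum T = - resolvent_set T"

definition wot_tendsto :: "(nat \<Rightarrow> 'a::complex_inner \<Rightarrow> 'a) \<Rightarrow> ('a \<Rightarrow> 'a) \<Rightarrow> bool"
  where "wot_tendsto T T' \<longleftrightarrow>
    (\<forall>\<psi> \<phi>. (\<lambda>j. cinner (T j \<psi>) \<phi>) \<longlonglongrightarrow> cinner (T' \<psi>) \<phi>)"

section \<open>Resolutions of the identity\<close>

definition projection_valued_measure ::
    "'b measure \<Rightarrow> ('b set \<Rightarrow> 'a::complex_inner \<Rightarrow> 'a) \<Rightarrow> bool"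
  where "projection_valued_measure M P \<longleftrightarrow>
    (\<forall>A\<in>sets M. orthogonal_projection (P A)) \<and>
    P {} = (\<lambda>x. 0) \<and> P (space M) = id \<and>
    (\<forall>A\<in>sets M. \<forall>B\<in>sets M. P (A \<inter> B) = P A \<circ> P B) \<and>
    (\<forall>A. range A \<subseteq> sets M \<longrightarrow> disjoint_family A \<longrightarrow>
       (\<forall>x. (\<lambda>n. P (A n) x) sums P (\<Union>n. A n) x))"

abbreviation unit_circle :: "complex set"
  where "unit_circle \<equiv> sphere 0 1"

definition circle_algebra :: "complex measure"
  where "circle_algebra = restrict_space borel unit_circle"

text \<open>The scalar measure \<open>A \<mapsto> \<langle>P(A)\<psi>, \<psi>\<rangle>\<close>; its values are real and nonnegative because every
  \<open>P(A)\<close> is an orthogonal projection.\<close>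

definition scalar_spectral_measure ::
    "(complex set \<Rightarrow> 'a::complex_inner \<Rightarrow> 'a) \<Rightarrow> 'a \<Rightarrow> complex measure"
  where "scalar_spectral_measure P \<psi> =
    measure_of unit_circle (sets circle_algebra) (\<lambda>A. ennreal (Re (cinner (P A \<psi>) \<psi>)))"

text \<open>\<open>U = \<integral> z dP(z)\<close> is understood weakly. By polarization it is enough to require it on the
  diagonal, where only the positive measures \<open>\<langle>P(\<sqdot>)\<psi>, \<psi>\<rangle>\<close> are involved. By the spectral theorem
  exactly one such \<open>P\<close> (on Borel sets) exists for each unitary \<open>U\<close>. Values of \<open>P\<close> on sets that
  are not Borel subsets of the circle are irrelevant.\<close>

definition resolution_of_identity ::
    "('a::complex_inner \<Rightarrow> 'a) \<Rightarrow> (complex set \<Rightarrow> 'a \<Rightarrow> 'a) \<Rightarrow> bool"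
  where "resolution_of_identity U P \<longleftrightarrow>
    projection_valued_measure circle_algebra P \<and>
    (\<forall>\<psi>. cinner (U \<psi>) \<psi> = (\<integral>z. z \<partial>scalar_spectral_measure P \<psi>))"

section \<open>Ergodic averages\<close>

definition ergodic_average :: "('a::real_vector \<Rightarrow> 'a) \<Rightarrow> nat \<Rightarrow> 'a \<Rightarrow> 'a"
  where "ergodic_average U K \<psi> = (1 / real K) *\<^sub>R (\<Sum>j<K. (U ^^ j) \<psi>)"

text \<open>The parameter \<open>P\<close> is meant to be the resolution of the identity of \<open>U\<close>, so that
  \<open>P {1} \<psi>\<close> is the projection of \<open>\<psi>\<close> onto the fixed vectors of \<open>U\<close>. The term at \<open>K = 0\<close> does
  not affect the upper and lower limits, which are taken in the extended reals.\<close>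

definition slow_fast_set ::
    "('a::complex_inner \<Rightarrow> 'a) \<Rightarrow> (complex set \<Rightarrow> 'a \<Rightarrow> 'a) \<Rightarrow> 'a set"
  where "slow_fast_set U P = {\<psi>. \<forall>\<epsilon>>0.
    limsup (\<lambda>K. ereal (real K powr \<epsilon> * (norm (ergodic_average U K \<psi> - P {1} \<psi>))\<^sup>2)) = \<infinity> \<and>
    liminf (\<lambda>K. ereal (real K powr (2 - \<epsilon>) * (norm (ergodic_average U K \<psi> - P {1} \<psi>))\<^sup>2)) = 0}"

end

theory Submission
  imports Defs
begin

text \<open>Each of the two growth conditions is a countable intersection of open conditions, so by Baire
  it suffices to show that each of these open sets is dense. For the \<open>liminf\<close> condition, vectors
  \<open>\<phi> + v - U v\<close> with \<open>U \<phi> = \<phi>\<close> are dense and their averages converge at rate \<open>1/K\<close>. For the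
  \<open>limsup\<close> condition, spectrum of \<open>U\<close> accumulating at \<open>1\<close> yields, for each fixed \<open>K\<close>, a unit vector
  \<open>x\<close> orthogonal to the fixed space that is moved so little that its \<open>K\<close>-th average still has norm
  at least \<open>1/2\<close>; adding a small multiple of \<open>x\<close> to an arbitrary vector makes the error large at
  time \<open>K\<close>.\<close>

section \<open>Mean ergodic decomposition\<close>

text \<open>A unitary seen through its real inner product. Carrying the inverse \<open>V\<close> as
  a parameter makes the adjoint of \<open>U\<close> an explicit function.\<close>

locale orthogonal_equiv =
  fixes U V :: "'a::real_inner \<Rightarrow> 'a"
  assumes bl_U: "bounded_linear U" and bl_V: "bounded_linear V"
    and UV [simp]: "U (V x) = x" and VU [simp]: "V (U x) = x"
    and inner_UU [simp]: "inner (U x) (U y) = inner x y"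
begin

lemma inner_U_left: "inner (U x) y = inner x (V y)"
  by (metis UV inner_UU)

lemma inner_V_left: "inner (V x) y = inner x (U y)"
  by (metis UV inner_UU)

lemma norm_U [simp]: "norm (U x) = norm x"
  by (simp add: norm_eq_sqrt_inner)

lemma norm_V [simp]: "norm (V x) = norm x"
  by (metis UV norm_U)

lemmas U_simps = linear_add[OF bounded_linear.linear[OF bl_U]]
  linear_diff[OF bounded_linear.linear[OF bl_U]]
  linear_scale[OF bounded_linear.linear[OF bl_U]]

lemmas V_simps = linear_add[OF bounded_linear.linear[OF bl_V]]
  linear_diff[OF bounded_linear.linear[OF bl_V]]
  linear_scale[OF bounded_linear.linear[OF bl_V]]

text \<open>A square-root-like factor: \<open>sym_avg\<close> is \<open>(1 + V) / 2\<close> after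
  \<open>(1 + U) / 2\<close>, and these two are adjoint to each other. This gives positivity of
  \<open>sym_avg\<close> and the comparison of the two norms.\<close>

definition half_avg :: "'a \<Rightarrow> 'a"
  where "half_avg x = (1/2) *\<^sub>R (x + U x)"

definition sym_avg :: "'a \<Rightarrow> 'a"
  where "sym_avg x = (1/4) *\<^sub>R (x + x + U x + V x)"

lemma inner_sym_avg_left: "inner (sym_avg x) y = inner x (sym_avg y)"
  by (simp add: sym_avg_def inner_add_left inner_add_right inner_U_left inner_V_left)

lemma inner_sym_avg_self: "inner (sym_avg x) x = (norm (half_avg x))\<^sup>2"
  by (simp add: sym_avg_def half_avg_def power_divide power2_norm_eq_inner inner_add_left inner_add_right
      inner_V_left inner_commute[of x "U x"])

lemma norm_half_avg_le: "norm (half_avg x) \<le> norm x"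
  using norm_triangle_ineq[of x "U x"] by (simp add: half_avg_def)

lemma norm_sym_avg_le_half_avg: "norm (sym_avg x) \<le> norm (half_avg x)"
proof -
  have "sym_avg x = (1/2) *\<^sub>R (half_avg x + V (half_avg x))"
    by (simp add: sym_avg_def half_avg_def U_simps V_simps algebra_simps)
  then show ?thesis
    using norm_triangle_ineq[of "half_avg x" "V (half_avg x)"] by simp
qed

text \<open>Parallelogram law for \<open>x\<close> and \<open>U x\<close>, which have equal norms:
  no loss of norm in the midpoint forces the two vectors to coincide.\<close>

lemma norm_half_avg_eq_imp_fixed:
  assumes "norm (half_avg x) = norm x"
  shows "U x = x"
proof -
  have "(norm (x - U x))\<^sup>2 = 4 * (norm x)\<^sup>2 - 4 * (norm (half_avg x))\<^sup>2"
    by (simp add: half_avg_def power_divide power2_norm_eq_inner inner_add_left inner_add_right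
        inner_diff_left inner_diff_right inner_commute[of x "U x"] field_simps)
  with assms show ?thesis by simp
qed

lemma bounded_linear_sym_avg: "bounded_linear sym_avg"
  unfolding sym_avg_def[abs_def]
  by (intro bounded_linear_intros bounded_linear_add bounded_linear_const_scaleR
      bounded_linear_ident bl_U bl_V)

text \<open>Self-adjointness moves powers across the inner product, so the geometry of the whole
  orbit is encoded in one scalar sequence of moments.\<close>

lemma inner_sym_avg_pow:
  "inner ((sym_avg ^^ m) x) ((sym_avg ^^ n) x) = inner ((sym_avg ^^ (m + n)) x) x"
proof (induction n arbitrary: m)
  case (Suc n)
  have "inner ((sym_avg ^^ m) x) ((sym_avg ^^ Suc n) x)
      = inner ((sym_avg ^^ Suc m) x) ((sym_avg ^^ n) x)"
    by (simp add: inner_sym_avg_left)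
  with Suc[of "Suc m"] show ?case by simp
qed simp

lemma decseq_inner_sym_avg_pow: "decseq (\<lambda>n. inner ((sym_avg ^^ n) x) x)"
proof (rule decseq_SucI)
  fix n :: nat
  obtain m where "n = m + m \<or> n = Suc (m + m)"
    by (metis mult_2 oddE evenE Suc_eq_plus1)
  then show "inner ((sym_avg ^^ Suc n) x) x \<le> inner ((sym_avg ^^ n) x) x"
  proof
    \<comment> \<open>With \<open>?y\<close> the m-th iterate, the moments of order 2m, 2m+1 and
      2m+2 are the squared norms of \<open>?y\<close>, \<open>half_avg ?y\<close> and
      \<open>sym_avg ?y\<close>. The two parities are the two norm comparisons between them.\<close>
    assume n: "n = m + m"
    let ?y = "(sym_avg ^^ m) x"
    have "(norm (half_avg ?y))\<^sup>2 \<le> (norm ?y)\<^sup>2"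
      by (simp add: norm_half_avg_le power_mono)
    then show ?thesis
      using inner_sym_avg_self[of ?y] inner_sym_avg_pow[of "Suc m" x m]
        inner_sym_avg_pow[of m x m] n by (simp add: power2_norm_eq_inner)
  next
    assume n: "n = Suc (m + m)"
    let ?y = "(sym_avg ^^ m) x"
    have "(norm (sym_avg ?y))\<^sup>2 \<le> (norm (half_avg ?y))\<^sup>2"
      by (simp add: norm_sym_avg_le_half_avg power_mono)
    then show ?thesis
      using inner_sym_avg_self[of ?y] inner_sym_avg_pow[of "Suc m" x m]
        inner_sym_avg_pow[of "Suc m" x "Suc m"] n by (simp add: power2_norm_eq_inner)
  qed
qed

text \<open>The squared distance of two iterates is a combination of moments with coefficients 1,
  -2, 1, so convergence of the decreasing moment sequence suffices.\<close>

lemma Cauchy_sym_avg_pow: "Cauchy (\<lambda>n. (sym_avg ^^ n) x)"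
proof -
  define a where "a n = inner ((sym_avg ^^ n) x) x" for n
  have even_nonneg: "0 \<le> a (m + m)" for m
    using inner_sym_avg_pow[of m x m] inner_ge_zero[of "(sym_avg ^^ m) x"] by (simp add: a_def)
  have dec: "decseq a"
    unfolding a_def by (rule decseq_inner_sym_avg_pow)
  \<comment> \<open>Odd moments are not squared norms of iterates, but monotonicity bounds
    \<open>a n\<close> below by the even moment \<open>a (n + n)\<close>.\<close>
  have "0 \<le> a n" for n
    using even_nonneg[of n] decseqD[OF dec, of n "n + n"] by simp
  then obtain L where "a \<longlonglongrightarrow> L"
    using decseq_convergent[OF dec] by metis
  then have "Cauchy a"
    by (simp add: LIMSEQ_imp_Cauchy)
  have dist_sq: "(norm ((sym_avg ^^ m) x - (sym_avg ^^ n) x))\<^sup>2 = a (m + m) - 2 * a (m + n) + a (n + n)"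
    for m n
    using inner_sym_avg_pow[of m x m] inner_sym_avg_pow[of m x n] inner_sym_avg_pow[of n x n]
    by (simp add: a_def power2_norm_eq_inner inner_diff_left inner_diff_right
        inner_commute[of "(sym_avg ^^ n) x" "(sym_avg ^^ m) x"])
  show ?thesis
    unfolding Cauchy_iff
  proof (intro allI impI)
    fix e :: real assume "0 < e"
    then have "0 < e\<^sup>2 / 2" by simp
    from \<open>Cauchy a\<close>[unfolded Cauchy_iff, rule_format, OF this]
    obtain M where M: "\<And>m n. m \<ge> M \<Longrightarrow> n \<ge> M \<Longrightarrow> \<bar>a m - a n\<bar> < e\<^sup>2 / 2" by auto
    show "\<exists>M. \<forall>m\<ge>M. \<forall>n\<ge>M. norm ((sym_avg ^^ m) x - (sym_avg ^^ n) x) < e"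
    proof (intro exI allI impI)
      fix m n assume "M \<le> m" "M \<le> n"
      then have "\<bar>a (m + m) - a (m + n)\<bar> < e\<^sup>2 / 2" "\<bar>a (n + n) - a (m + n)\<bar> < e\<^sup>2 / 2"
        by (intro M; simp)+
      then have "(norm ((sym_avg ^^ m) x - (sym_avg ^^ n) x))\<^sup>2 < e\<^sup>2"
        unfolding dist_sq by linarith
      then show "norm ((sym_avg ^^ m) x - (sym_avg ^^ n) x) < e"
        using \<open>0 < e\<close> by (simp add: power2_less_imp_less)
    qed
  qed
qed

lemma subspace_coboundaries: "subspace (range (\<lambda>v. v - U v))"
  by (intro linear_subspace_image subspace_UNIV linear_compose_sub linear_ident
      bounded_linear.linear[OF bl_U])

lemma diff_sym_avg_pow_coboundary: "x - (sym_avg ^^ n) x \<in> range (\<lambda>v. v - U v)"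
proof (induction n)
  case 0
  show ?case using subspace_0[OF subspace_coboundaries] by simp
next
  case (Suc n)
  let ?w = "(sym_avg ^^ n) x"
  \<comment> \<open>From \<open>2 - U - V = (1 - U) (1 - V)\<close>: each iteration changes the
    vector by a coboundary.\<close>
  have "?w - sym_avg ?w = (1/4) *\<^sub>R (?w - V ?w) - U ((1/4) *\<^sub>R (?w - V ?w))"
    by (simp add: sym_avg_def U_simps algebra_simps flip: scaleR_add_left)
  then have "?w - sym_avg ?w \<in> range (\<lambda>v. v - U v)" by blast
  from subspace_add[OF subspace_coboundaries Suc this] show ?case by simp
qed

end

locale complete_orthogonal_equiv = orthogonal_equiv U V
  for U V :: "'a::{real_inner,complete_space} \<Rightarrow> 'a"
begin

text \<open>\<open>sym_avg = (2 + U + U\<^sup>*) / 4\<close> is a positive self-adjoint contraction, so its powers converge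
  strongly.\<close>

lemma mean_ergodic_decomposition:
  "\<exists>y. U y = y \<and> x - y \<in> closure (range (\<lambda>v. v - U v))"
proof -
  obtain y where lim: "(\<lambda>n. (sym_avg ^^ n) x) \<longlonglongrightarrow> y"
    using Cauchy_convergent[OF Cauchy_sym_avg_pow] by (auto simp: convergent_def)
  have "(\<lambda>n. sym_avg ((sym_avg ^^ n) x)) \<longlonglongrightarrow> sym_avg y"
    by (rule bounded_linear.tendsto[OF bounded_linear_sym_avg lim])
  moreover have "(\<lambda>n. sym_avg ((sym_avg ^^ n) x)) \<longlonglongrightarrow> y"
    using LIMSEQ_Suc[OF lim] by simp
  ultimately have "sym_avg y = y"
    by (rule LIMSEQ_unique)
  \<comment> \<open>The norm of \<open>half_avg y\<close> is squeezed between those of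
    \<open>sym_avg y = y\<close> and \<open>y\<close>.\<close>
  then have "norm (half_avg y) = norm y"
    using norm_half_avg_le[of y] norm_sym_avg_le_half_avg[of y] by simp
  then have "U y = y"
    by (rule norm_half_avg_eq_imp_fixed)
  moreover have "x - y \<in> closure (range (\<lambda>v. v - U v))"
    unfolding closure_sequential
    using lim diff_sym_avg_pow_coboundary
    by (intro exI[of _ "\<lambda>n. x - (sym_avg ^^ n) x"]) (auto intro: tendsto_diff tendsto_const)
  ultimately show ?thesis by blast
qed

end

section \<open>Approximate eigenvectors\<close>

text \<open>Solving \<open>x = A y\<close> means finding a fixed point of
  \<open>\<lambda>y. y - A y + x\<close>, which is a contraction with constant
  \<open>c\<close>.\<close>

lemma surj_if_near_identity:
  fixes A :: "'a::{real_normed_vector,complete_space} \<Rightarrow> 'a"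
  assumes "linear A" "0 \<le> c" "c < 1" and A: "\<And>y. norm (y - A y) \<le> c * norm y"
  shows "surj A"
proof -
  have "\<exists>y. x = A y" for x
  proof -
    have "dist (y - A y + x) (z - A z + x) \<le> c * dist y z" for y z
      using A[of "y - z"] by (simp add: dist_norm linear_diff[OF assms(1)] algebra_simps)
    then obtain y where "y - A y + x = y"
      using banach_fix_type[of c "\<lambda>y. y - A y + x"] assms(2,3) by metis
    then show ?thesis by (intro exI[of _ y]) (simp add: algebra_simps)
  qed
  then show ?thesis by blast
qed

section \<open>Complex scalars and the real inner product\<close>

lemma scaleC_one [simp]: "1 *\<^sub>C x = (x::'a::complex_inner)"
  using scaleC_of_real[of 1 x] by simp

lemma scaleC_scaleR: "a *\<^sub>C (r *\<^sub>R x) = r *\<^sub>R (a *\<^sub>C (x::'a::complex_inner))"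
  by (metis scaleC_of_real scaleC_scaleC mult.commute)

lemma linear_scaleC: "linear (\<lambda>x::'a::complex_inner. a *\<^sub>C x)"
  by (rule linearI) (simp_all add: scaleC_add_right scaleC_scaleR)

lemmas scaleC_diff_right = linear_diff[OF linear_scaleC]

lemma cinner_scaleC_right: "cinner x (a *\<^sub>C y) = cnj a * cinner x y"
  by (metis cinner_commute cinner_scaleC_left complex_cnj_mult complex_cnj_cnj)

lemma inner_scaleC_left: "inner (a *\<^sub>C x) y = inner (x::'a::complex_inner) (cnj a *\<^sub>C y)"
  by (simp add: inner_eq_Re_cinner cinner_scaleC_left cinner_scaleC_right)

lemma norm_scaleC: "norm (a *\<^sub>C x) = cmod a * norm (x::'a::complex_inner)"
proof -
  have "(norm (a *\<^sub>C x))\<^sup>2 = inner x ((cnj a * a) *\<^sub>C x)"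
    by (simp add: power2_norm_eq_inner inner_scaleC_left scaleC_scaleC)
  also have "cnj a * a = complex_of_real ((cmod a)\<^sup>2)"
    by (simp only: complex_norm_square mult.commute)
  also have "inner x (complex_of_real ((cmod a)\<^sup>2) *\<^sub>C x) = (cmod a * norm x)\<^sup>2"
    unfolding scaleC_of_real by (simp add: power2_norm_eq_inner power_mult_distrib)
  finally show ?thesis by simp
qed

lemma unitary_operator_inv:
  fixes U :: "'a::complex_inner \<Rightarrow> 'a"
  assumes "unitary_operator U"
  shows "orthogonal_equiv U (inv U)"
proof -
  have bl: "bounded_linear U" and surj: "surj U"
    and inner: "\<And>x y. inner (U x) (U y) = inner x y"
    using assms by (auto simp: unitary_operator_def bounded_clinear_def inner_eq_Re_cinner)
  then have norm: "norm (U x) = norm x" for x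
    by (simp add: norm_eq_sqrt_inner)
  have "inj U"
    unfolding linear_injective_0[OF bounded_linear.linear[OF bl]] by (metis norm norm_eq_zero)
  then have "U (inv U x) = x" "inv U (U x) = x" for x
    using surj by (simp_all add: surj_f_inv_f)
  moreover have "bounded_linear (inv U)"
  proof (rule bounded_linear_intro[where K = 1])
    fix x y :: 'a and r :: real
    show "inv U (x + y) = inv U x + inv U y"
      by (metis calculation linear_add[OF bounded_linear.linear[OF bl]])
    show "inv U (r *\<^sub>R x) = r *\<^sub>R inv U x"
      by (metis calculation linear_scale[OF bounded_linear.linear[OF bl]])
    show "norm (inv U x) \<le> norm x * 1"
      by (metis calculation(1) norm mult_1_right order_refl)
  qed
  ultimately show ?thesis
    using bl inner by (intro orthogonal_equiv.intro)
qed

text \<open>Since \<open>T = U - z\<close> is normal, \<open>T\<^sup>* T\<close> is within distance \<open>c < 1\<close> of the identity after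
  rescaling, so \<open>T\<^sup>*\<close> is onto, and \<open>T\<^sup>*\<close> is as injective as \<open>T\<close>.\<close>

lemma resolvent_set_if_bounded_below:
  fixes U :: "'a::complex_hilbert_space \<Rightarrow> 'a"
  assumes "unitary_operator U" "0 < d" and below: "\<And>x. d * norm x \<le> norm (U x - z *\<^sub>C x)"
  shows "z \<in> resolvent_set U"
proof -
  interpret orthogonal_equiv U "inv U"
    by (rule unitary_operator_inv[OF assms(1)])
  have U_scaleC: "U (a *\<^sub>C x) = a *\<^sub>C U x" for a x
    using assms(1) by (auto simp: unitary_operator_def bounded_clinear_def)
  define T where "T x = U x - z *\<^sub>C x" for x
  define S where "S x = inv U x - cnj z *\<^sub>C x" for x
  have lin_T: "linear T" and lin_S: "linear S"
    unfolding T_def S_def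
    by (intro linear_compose_sub linear_scaleC bounded_linear.linear bl_U bl_V)+
  have adj: "inner (T x) y = inner x (S y)" for x y
    by (simp add: T_def S_def inner_diff_left inner_diff_right inner_U_left inner_scaleC_left)
  have V_scaleC: "inv U (a *\<^sub>C x) = a *\<^sub>C inv U x" for a x
    by (metis UV VU U_scaleC)
  have comm: "T (S x) = S (T x)" for x
    by (simp add: T_def S_def U_simps V_simps U_scaleC V_scaleC scaleC_diff_right scaleC_scaleC
        mult.commute)
  \<comment> \<open>Normality: \<open>S\<close> is the adjoint of \<open>T\<close> and commutes with
    it.\<close>
  have norm_S: "norm (S x) = norm (T x)" for x
  proof -
    have "inner (S x) (S x) = inner (T x) (T x)"
      by (metis adj comm inner_commute)
    then show ?thesis by (simp add: norm_eq_sqrt_inner)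
  qed
  \<comment> \<open>The first two summands bound the norm of \<open>T\<close>, as \<open>U\<close>
    is isometric. The summand \<open>d\<close> ensures \<open>d < M\<close>, so that
    \<open>c\<close> below lies strictly below 1.\<close>
  define M where "M = 1 + cmod z + d"
  have "0 < M" "d < M"
    using \<open>0 < d\<close> norm_ge_zero[of z] by (auto simp: M_def intro: add_pos_nonneg simp del: norm_ge_zero)
  have norm_T: "norm (T x) \<le> M * norm x" for x
  proof -
    have "norm (T x) \<le> norm x + cmod z * norm x"
      unfolding T_def using norm_triangle_ineq4[of "U x" "z *\<^sub>C x"] by (simp add: norm_scaleC)
    also have "\<dots> \<le> M * norm x"
      using \<open>0 < d\<close> by (simp add: M_def algebra_simps)
    finally show ?thesis .
  qed
  \<comment> \<open>Expanding the square of \<open>norm (y - A y)\<close> gives a cross term of -2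
    times the square of \<open>norm (T y) / M\<close>. The quadratic term returns at most one of
    these, and the lower bound \<open>d\<close> on \<open>T\<close> controls the rest.\<close>
  define c where "c = sqrt (1 - d\<^sup>2 / M\<^sup>2)"
  have "d\<^sup>2 / M\<^sup>2 < 1" "0 < d\<^sup>2 / M\<^sup>2"
    using \<open>0 < d\<close> \<open>d < M\<close> \<open>0 < M\<close> by (simp_all add: power_strict_mono)
  then have c: "0 \<le> c" "c < 1" "c\<^sup>2 = 1 - d\<^sup>2 / M\<^sup>2"
    by (auto simp: c_def)
  define A where "A y = (1 / M\<^sup>2) *\<^sub>R S (T y)" for y
  have lin_A: "linear A"
    unfolding A_def
    by (intro linear_compose_scale_right linear_compose[OF lin_T lin_S, unfolded o_def])
  have "norm (y - A y) \<le> c * norm y" for y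
  proof -
    have 1: "(norm (S (T y)))\<^sup>2 / (M\<^sup>2 * M\<^sup>2) \<le> (norm (T y))\<^sup>2 / M\<^sup>2"
    proof -
      have "(norm (S (T y)))\<^sup>2 \<le> (M * norm (T y))\<^sup>2"
        unfolding norm_S by (intro power_mono norm_T) simp
      from divide_right_mono[OF this, of "M\<^sup>2 * M\<^sup>2"]
      have "(norm (S (T y)))\<^sup>2 / (M\<^sup>2 * M\<^sup>2) \<le> (M * norm (T y))\<^sup>2 / (M\<^sup>2 * M\<^sup>2)"
        by simp
      also have "\<dots> = (norm (T y))\<^sup>2 / M\<^sup>2"
        unfolding power_mult_distrib using \<open>0 < M\<close>
        by (intro nonzero_mult_divide_mult_cancel_left) simp
      finally show ?thesis .
    qed
    have 2: "d\<^sup>2 / M\<^sup>2 * (norm y)\<^sup>2 \<le> (norm (T y))\<^sup>2 / M\<^sup>2"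
    proof -
      have "(d * norm y)\<^sup>2 \<le> (norm (T y))\<^sup>2"
        unfolding T_def using \<open>0 < d\<close> by (intro power_mono below) simp
      from divide_right_mono[OF this, of "M\<^sup>2"] show ?thesis
        by (simp add: power_mult_distrib)
    qed
    have "inner y (S (T y)) = (norm (T y))\<^sup>2"
      by (simp add: adj[symmetric] power2_norm_eq_inner)
    moreover have "(norm (y - t *\<^sub>R w))\<^sup>2 = (norm y)\<^sup>2 - 2 * (t * inner y w) + t\<^sup>2 * (norm w)\<^sup>2" for t w
      unfolding power2_norm_eq_inner
      by (simp add: inner_diff_left inner_diff_right inner_commute[of w y] power2_eq_square algebra_simps)
    ultimately have "(norm (y - A y))\<^sup>2
        = (norm y)\<^sup>2 - 2 * ((norm (T y))\<^sup>2 / M\<^sup>2) + (norm (S (T y)))\<^sup>2 / (M\<^sup>2 * M\<^sup>2)"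
      by (simp add: A_def power_divide power2_eq_square)
    also have "\<dots> \<le> (norm y)\<^sup>2 - d\<^sup>2 / M\<^sup>2 * (norm y)\<^sup>2"
      using 1 2 by linarith
    also have "\<dots> = (c * norm y)\<^sup>2"
      by (simp add: power_mult_distrib c(3) left_diff_distrib)
    finally show ?thesis
      by (rule power2_le_imp_le) (simp add: c)
  qed
  then have "surj A"
    by (rule surj_if_near_identity[OF lin_A c(1,2)])
  have inj: "x = y" if "norm (T (x - y)) = 0" for x y
  proof -
    have "d * norm (x - y) \<le> 0"
      using below[of "x - y"] that unfolding T_def by linarith
    then show ?thesis
      using \<open>0 < d\<close> by (simp add: mult_le_0_iff)
  qed
  have inj_T: "T x = T y \<Longrightarrow> x = y" for x y
    by (rule inj) (simp add: linear_diff[OF lin_T])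
  have inj_S: "S x = S y \<Longrightarrow> x = y" for x y
    by (rule inj) (simp add: linear_diff[OF lin_S] flip: norm_S)
  \<comment> \<open>Surjectivity of \<open>A\<close> writes \<open>S x\<close> as \<open>S\<close>
    of a value of \<open>T\<close>, and injectivity of \<open>S\<close> cancels
    \<open>S\<close>.\<close>
  have "surj T"
  proof -
    have "\<exists>y. x = T y" for x
    proof -
      obtain y where y: "S x = A y"
        using \<open>surj A\<close> by (metis surjD)
      then have "S x = S (T ((1 / M\<^sup>2) *\<^sub>R y))"
        by (simp add: A_def linear_scale[OF lin_T] linear_scale[OF lin_S])
      then show ?thesis
        using inj_S by blast
    qed
    then show ?thesis by blast
  qed
  define R where "R = inv T"
  have TR: "T (R x) = x" and RT: "R (T x) = x" for x
    using \<open>surj T\<close> inj_T by (auto simp: R_def surj_f_inv_f inj_def inv_f_f)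
  have T_scaleC: "T (a *\<^sub>C x) = a *\<^sub>C T x" for a x
    by (simp add: T_def U_scaleC scaleC_diff_right scaleC_scaleC mult.commute)
  have "bounded_linear R"
  proof (rule bounded_linear_intro[where K = "1 / d"])
    fix x y :: 'a and r :: real
    show "R (x + y) = R x + R y"
      by (metis TR RT linear_add[OF lin_T])
    show "R (r *\<^sub>R x) = r *\<^sub>R R x"
      by (metis TR RT linear_scale[OF lin_T])
    show "norm (R x) \<le> norm x * (1 / d)"
      using below[of "R x"] TR[of x] \<open>0 < d\<close> by (simp add: T_def field_simps)
  qed
  moreover have "R (a *\<^sub>C x) = a *\<^sub>C R x" for a x
    by (metis TR RT T_scaleC)
  ultimately show ?thesis
    using TR RT by (auto simp: resolvent_set_def bounded_clinear_def simp flip: T_def intro!: exI[of _ R])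
qed

section \<open>The fixed space as a spectral subspace\<close>

lemma orthogonal_projection_inner:
  fixes Q :: "'a::complex_inner \<Rightarrow> 'a"
  assumes "orthogonal_projection Q"
  shows "bounded_linear Q" "Q (Q x) = Q x" "inner (Q x) y = inner x (Q y)"
    "inner (Q x) x = (norm (Q x))\<^sup>2"
proof -
  show *: "bounded_linear Q" "Q (Q x) = Q x" "inner (Q x) y = inner x (Q y)" for x y
    using assms by (auto simp: orthogonal_projection_def bounded_clinear_def inner_eq_Re_cinner
        fun_eq_iff)
  show "inner (Q x) x = (norm (Q x))\<^sup>2"
    unfolding power2_norm_eq_inner by (metis * inner_commute)
qed

lemma norm_diff_orthogonal_projection:
  fixes Q :: "'a::complex_inner \<Rightarrow> 'a"
  assumes "orthogonal_projection Q"
  shows "(norm (x - Q x))\<^sup>2 = (norm x)\<^sup>2 - (norm (Q x))\<^sup>2"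
  using orthogonal_projection_inner(4)[OF assms, of x]
  by (simp add: power2_norm_eq_inner inner_diff_left inner_diff_right inner_commute[of x "Q x"])

lemma norm_orthogonal_projection_le:
  fixes Q :: "'a::complex_inner \<Rightarrow> 'a"
  assumes "orthogonal_projection Q"
  shows "norm (Q x) \<le> norm x"
proof (rule power2_le_imp_le)
  show "(norm (Q x))\<^sup>2 \<le> (norm x)\<^sup>2"
    using norm_diff_orthogonal_projection[OF assms, of x] zero_le_power2[of "norm (x - Q x)"]
    by linarith
qed simp

section \<open>Scalar spectral measures on the circle\<close>

lemma space_circle_algebra [simp]: "space circle_algebra = unit_circle"
  by (simp add: circle_algebra_def space_restrict_space)

lemma one_in_circle_algebra [simp]: "{1} \<in> sets circle_algebra"
  by (simp add: circle_algebra_def sets_restrict_space_iff)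

lemma sets_scalar_spectral_measure [simp]:
  "sets (scalar_spectral_measure P \<psi>) = sets circle_algebra"
  using sets.space_closed[of circle_algebra] sets.sigma_sets_eq[of circle_algebra]
  by (simp add: scalar_spectral_measure_def)

lemma space_scalar_spectral_measure [simp]: "space (scalar_spectral_measure P \<psi>) = unit_circle"
  using sets_eq_imp_space_eq[OF sets_scalar_spectral_measure] by simp

text \<open>\<open>measure_of\<close> takes the prescribed values only once they are known to be
  countably additive. That follows by pairing the strongly convergent sums of projections with
  \<open>\<psi>\<close>.\<close>

lemma emeasure_scalar_spectral_measure:
  assumes P: "projection_valued_measure circle_algebra P" and A: "A \<in> sets circle_algebra"
  shows "emeasure (scalar_spectral_measure P \<psi>) A = ennreal ((norm (P A \<psi>))\<^sup>2)"
proof -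
  have proj: "Re (cinner (P A \<psi>) \<psi>) = (norm (P A \<psi>))\<^sup>2" if "A \<in> sets circle_algebra" for A
    using orthogonal_projection_inner(4) P that
    by (metis projection_valued_measure_def inner_eq_Re_cinner)
  have "emeasure (scalar_spectral_measure P \<psi>) A = ennreal (Re (cinner (P A \<psi>) \<psi>))"
  proof (rule emeasure_measure_of[OF scalar_spectral_measure_def])
    show "sets circle_algebra \<subseteq> Pow unit_circle"
      using sets.space_closed[of circle_algebra] by simp
    show "positive (sets (scalar_spectral_measure P \<psi>)) (\<lambda>A. ennreal (Re (cinner (P A \<psi>) \<psi>)))"
      using P by (auto simp: positive_def projection_valued_measure_def inner_eq_Re_cinner[symmetric])
    show "countably_additive (sets (scalar_spectral_measure P \<psi>))
        (\<lambda>A. ennreal (Re (cinner (P A \<psi>) \<psi>)))"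
      unfolding countably_additive_def sets_scalar_spectral_measure
    proof (intro allI impI)
      fix F :: "nat \<Rightarrow> complex set"
      assume F: "range F \<subseteq> sets circle_algebra" "disjoint_family F"
      then have "(\<lambda>n. P (F n) \<psi>) sums P (\<Union>n. F n) \<psi>"
        using P by (auto simp: projection_valued_measure_def)
      then have "(\<lambda>n. inner (P (F n) \<psi>) \<psi>) sums inner (P (\<Union>n. F n) \<psi>) \<psi>"
        by (rule bounded_linear.sums[OF bounded_linear_inner_left])
      then show "(\<Sum>n. ennreal (Re (cinner (P (F n) \<psi>) \<psi>)))
          = ennreal (Re (cinner (P (\<Union> (range F)) \<psi>) \<psi>))"
        using F by (intro suminf_ennreal_eq) (auto simp: inner_eq_Re_cinner proj)
    qed
  qed (use A in simp)
  with proj[OF A] show ?thesis by simp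
qed

text \<open>The squared norm of \<open>U \<psi> - \<psi>\<close> is twice the integral of
  \<open>1 - Re z\<close> against the scalar measure. The integrand is nonnegative on the circle and
  vanishes only at 1, so \<open>\<psi>\<close> is fixed exactly when all mass sits at 1.\<close>

lemma fixed_iff_spectral_projection_one:
  fixes U :: "'a::complex_inner \<Rightarrow> 'a"
  assumes U: "unitary_operator U" and res: "resolution_of_identity U P"
  shows "P {1} \<psi> = \<psi> \<longleftrightarrow> U \<psi> = \<psi>"
proof -
  interpret U: orthogonal_equiv U "inv U"
    by (rule unitary_operator_inv[OF U])
  have P: "projection_valued_measure circle_algebra P"
    and int: "cinner (U \<psi>) \<psi> = (\<integral>z. z \<partial>scalar_spectral_measure P \<psi>)"
    using res by (auto simp: resolution_of_identity_def)
  have P1: "orthogonal_projection (P {1})" and P_space: "P unit_circle \<psi> = \<psi>"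
    using P by (auto simp: projection_valued_measure_def)
  define \<mu> where "\<mu> = scalar_spectral_measure P \<psi>"
  have sets: "sets \<mu> = sets circle_algebra" and space: "space \<mu> = unit_circle"
    by (simp_all add: \<mu>_def)
  have total: "emeasure \<mu> unit_circle = ennreal ((norm \<psi>)\<^sup>2)"
    using emeasure_scalar_spectral_measure[OF P, of unit_circle \<psi>] sets.top[of circle_algebra] P_space
    by (simp add: \<mu>_def)
  have atom: "emeasure \<mu> {1} = ennreal ((norm (P {1} \<psi>))\<^sup>2)"
    using emeasure_scalar_spectral_measure[OF P, of "{1}" \<psi>] by (simp add: \<mu>_def)
  interpret finite_measure \<mu>
    by (rule finite_measureI) (simp add: space total)
  have total': "measure \<mu> unit_circle = (norm \<psi>)\<^sup>2"
    by (simp add: measure_def total)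
  have meas: "(\<lambda>z. z) \<in> borel_measurable \<mu>"
    unfolding measurable_cong_sets[OF sets refl] circle_algebra_def
    by (rule measurable_restrict_space1) simp
  have integrable: "integrable \<mu> (\<lambda>z. z)"
    by (rule integrable_const_bound[where B = 1, OF AE_I2 meas]) (simp add: space)
  have Re_int: "inner (U \<psi>) \<psi> = (\<integral>z. Re z \<partial>\<mu>)"
    using int integrable by (simp add: inner_eq_Re_cinner \<mu>_def integral_Re)
  show ?thesis
  proof
    assume fixed: "P {1} \<psi> = \<psi>"
    have "AE z in \<mu>. z = 1"
    proof (rule AE_I)
      show "emeasure \<mu> (unit_circle - {1}) = 0"
        using emeasure_compl[of "{1}" \<mu>] by (simp add: sets space total atom fixed)
      show "unit_circle - {1} \<in> Sigma_Algebra.sets \<mu>"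
        using sets.compl_sets[of "{1}" \<mu>] by (simp add: sets space)
    qed (auto simp: space)
    then have "(\<integral>z. Re z \<partial>\<mu>) = (\<integral>z. 1 \<partial>\<mu>)"
      using meas by (intro integral_cong_AE) auto
    then have "inner (U \<psi>) \<psi> = (norm \<psi>)\<^sup>2"
      by (simp add: Re_int space total')
    then have "(norm (U \<psi> - \<psi>))\<^sup>2 = 0"
      unfolding power2_norm_eq_inner
      by (simp add: inner_diff_left inner_diff_right inner_commute[of \<psi> "U \<psi>"])
    then show "U \<psi> = \<psi>" by simp
  next
    assume "U \<psi> = \<psi>"
    then have "(\<integral>z. Re z \<partial>\<mu>) = (norm \<psi>)\<^sup>2"
      by (simp add: Re_int[symmetric] power2_norm_eq_inner)
    moreover have "integrable \<mu> Re"
      using integrable by (rule integrable_Re)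
    ultimately have "(\<integral>z. 1 - Re z \<partial>\<mu>) = 0" "integrable \<mu> (\<lambda>z. 1 - Re z)"
      by (simp_all add: space total')
    moreover have nonneg: "0 \<le> 1 - Re z" if "z \<in> unit_circle" for z
      using that complex_Re_le_cmod[of z] by simp
    ultimately have "AE z in \<mu>. 1 - Re z = 0"
      by (subst (asm) integral_nonneg_eq_0_iff_AE) (auto simp: space intro!: AE_I2)
    moreover have "z = 1" if "z \<in> unit_circle" "1 - Re z = 0" for z
      using that by (auto simp: complex_eq_iff cmod_def)
    ultimately have "AE z in \<mu>. z \<in> {1} \<longleftrightarrow> z \<in> unit_circle"
      using AE_space[of \<mu>] unfolding space by (auto elim!: eventually_elim2)
    then have "emeasure \<mu> {1} = emeasure \<mu> unit_circle"
      using sets.top[of \<mu>] by (intro emeasure_eq_AE) (auto simp: sets space)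
    \<comment> \<open>By Pythagoras this square is the total mass minus the mass at 1.\<close>
    then have "(norm (\<psi> - P {1} \<psi>))\<^sup>2 = 0"
      by (simp add: total atom norm_diff_orthogonal_projection[OF P1])
    then show "P {1} \<psi> = \<psi>" by simp
  qed
qed

section \<open>Approximate fixed vectors orthogonal to the fixed space\<close>

text \<open>\<open>Q\<close> abstracts \<open>P {1}\<close>: the orthogonal projection onto the
  fixed vectors of \<open>U\<close>.\<close>

locale ergodic_projection = complete_orthogonal_equiv +
  fixes Q :: "'a \<Rightarrow> 'a"
  assumes bl_Q: "bounded_linear Q" and Q_idem [simp]: "Q (Q x) = Q x"
    and inner_Q_left: "inner (Q x) y = inner x (Q y)"
    and Q_fixed_iff: "Q x = x \<longleftrightarrow> U x = x"
begin

lemmas Q_simps = linear_add[OF bounded_linear.linear[OF bl_Q]]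
  linear_diff[OF bounded_linear.linear[OF bl_Q]]
  linear_scale[OF bounded_linear.linear[OF bl_Q]]

lemma U_Q [simp]: "U (Q x) = Q x"
  by (simp flip: Q_fixed_iff)

lemma Q_U [simp]: "Q (U x) = Q x"
proof -
  \<comment> \<open>Move \<open>Q\<close> to \<open>y\<close>; since \<open>Q y\<close> is fixed, it
    equals \<open>U (Q y)\<close>, and \<open>U\<close> then cancels on both sides.\<close>
  have "inner (Q (U x)) y = inner (Q x) y" for y
    by (metis inner_Q_left inner_UU U_Q)
  then show ?thesis
    using vector_eq_rdot by blast
qed

text \<open>\<open>Q\<close> vanishes on coboundaries, hence on their closure. Applying it to the
  mean ergodic decomposition of \<open>x - Q x\<close> therefore kills the fixed part
  \<open>y\<close>.\<close>

lemma diff_Q_in_closure_coboundaries: "x - Q x \<in> closure (range (\<lambda>v. v - U v))"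
proof -
  obtain y where y: "U y = y" "x - Q x - y \<in> closure (range (\<lambda>v. v - U v))"
    using mean_ergodic_decomposition by blast
  have "closed {z. Q z = 0}"
    using linear_continuous_on[OF bl_Q] by (intro closed_Collect_eq) (auto intro: continuous_on_const)
  moreover have "range (\<lambda>v. v - U v) \<subseteq> {z. Q z = 0}"
    by (auto simp: Q_simps)
  ultimately have "Q (x - Q x - y) = 0"
    using closure_minimal y(2) by blast
  then have "y = 0"
    using y(1) by (simp add: Q_simps flip: Q_fixed_iff)
  with y show ?thesis by simp
qed

end

lemma unitary_operator_ergodic_projection:
  fixes U :: "'a::complex_hilbert_space \<Rightarrow> 'a"
  assumes U: "unitary_operator U" and Q: "orthogonal_projection Q"
    and fixed: "\<And>x. Q x = x \<longleftrightarrow> U x = x"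
  shows "ergodic_projection U (inv U) Q"
  by (intro ergodic_projection.intro complete_orthogonal_equiv.intro ergodic_projection_axioms.intro
      unitary_operator_inv[OF U] orthogonal_projection_inner(1-3)[OF Q] fixed)

text \<open>A spectral point \<open>z\<close> near but different from 1 has approximate
  eigenvectors. Their fixed component is small because \<open>Q\<close> acts on
  \<open>U x - z *\<^sub>C x\<close> as multiplication of \<open>Q x\<close> by
  \<open>1 - z\<close>; subtracting it leaves a vector that can be normalized.\<close>

lemma approx_fixed_vector:
  fixes U :: "'a::complex_hilbert_space \<Rightarrow> 'a"
  assumes U: "unitary_operator U" and Q: "orthogonal_projection Q"
    and fixed: "\<And>x. Q x = x \<longleftrightarrow> U x = x"
    and lim: "1 islimpt op_spectrum U" and "0 < \<eta>"
  shows "\<exists>x. norm x = 1 \<and> Q x = 0 \<and> norm (U x - x) \<le> \<eta>"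
proof -
  interpret ergodic_projection U "inv U" Q
    using unitary_operator_ergodic_projection[OF U Q fixed] .
  have "\<exists>z\<in>op_spectrum U. z \<noteq> 1 \<and> dist z 1 < \<eta> / 3"
    using lim[unfolded islimpt_approachable, rule_format, of "\<eta> / 3"] \<open>0 < \<eta>\<close> by simp
  then obtain z where z: "z \<notin> resolvent_set U" "z \<noteq> 1" "cmod (1 - z) < \<eta> / 3"
    by (auto simp: op_spectrum_def dist_norm norm_minus_commute)
  define d where "d = cmod (1 - z)"
  have "0 < d" using z by (simp add: d_def)
  \<comment> \<open>The tolerance is proportional to the distance \<open>d\<close> of
    \<open>z\<close> from 1. Division by \<open>d\<close> then yields
    \<open>norm (Q x) \<le> norm x / 2\<close>, so at least half the norm survives in
    \<open>w\<close>.\<close>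
  have "\<exists>x. norm (U x - z *\<^sub>C x) < d / 2 * norm x"
  proof (rule ccontr)
    assume "\<not> ?thesis"
    then have "d / 2 * norm x \<le> norm (U x - z *\<^sub>C x)" for x
      by (meson not_less)
    then have "z \<in> resolvent_set U"
      using \<open>0 < d\<close> by (intro resolvent_set_if_bounded_below[OF U, of "d / 2"]) simp
    with z(1) show False ..
  qed
  then obtain x where x: "norm (U x - z *\<^sub>C x) < d / 2 * norm x" by blast
  have split_z: "z *\<^sub>C y = y - (1 - z) *\<^sub>C y" for y :: 'a
    using scaleC_add_left[of z "1 - z" y] by (simp add: eq_diff_eq)
  have "Q (U x - z *\<^sub>C x) = (1 - z) *\<^sub>C Q x"
  proof -
    have "Q (z *\<^sub>C x) = z *\<^sub>C Q x"
      using Q unfolding orthogonal_projection_def bounded_clinear_def by blast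
    then show ?thesis
      unfolding Q_simps Q_U split_z[of "Q x"] by simp
  qed
  then have "d * norm (Q x) \<le> d * (norm x / 2)"
    using norm_orthogonal_projection_le[OF Q, of "U x - z *\<^sub>C x"] x by (simp add: norm_scaleC d_def)
  then have Qx: "norm (Q x) \<le> norm x / 2"
    unfolding mult_le_cancel_left_pos[OF \<open>0 < d\<close>] .
  have "x \<noteq> 0"
    using le_less_trans[OF norm_ge_zero x] by auto
  define w where "w = x - Q x"
  have norm_w: "norm x / 2 \<le> norm w"
    using norm_triangle_ineq2[of x "Q x"] Qx by (simp add: w_def)
  then have "0 < norm w"
    using less_le_trans[of 0 "norm x / 2" "norm w"] \<open>x \<noteq> 0\<close> by simp
  have "U w - w = (U x - z *\<^sub>C x) - (1 - z) *\<^sub>C x"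
    unfolding w_def U_simps U_Q split_z[of x] by simp
  then have "norm (U w - w) \<le> norm (U x - z *\<^sub>C x) + d * norm x"
    using norm_triangle_ineq4[of "U x - z *\<^sub>C x" "(1 - z) *\<^sub>C x"]
    unfolding norm_scaleC d_def by presburger
  \<comment> \<open>The total is \<open>d / 2 + d\<close> times \<open>norm x\<close>; this is why
    \<open>z\<close> was taken within \<open>\<eta> / 3\<close> of 1.\<close>
  also have "\<dots> \<le> 3 * d * (norm x / 2)"
    using x by linarith
  also have "\<dots> \<le> \<eta> * norm w"
  proof (intro mult_mono norm_w)
    show "3 * d \<le> \<eta>" using z(3) unfolding d_def by linarith
  qed (use \<open>0 < \<eta>\<close> in simp_all)
  finally have w: "norm (U w - w) \<le> \<eta> * norm w" .
  have "U ((1 / norm w) *\<^sub>R w) - (1 / norm w) *\<^sub>R w = (1 / norm w) *\<^sub>R (U w - w)"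
    unfolding U_simps scaleR_diff_right ..
  then have "norm (U ((1 / norm w) *\<^sub>R w) - (1 / norm w) *\<^sub>R w) = norm (U w - w) / norm w"
    by simp
  also have "\<dots> \<le> \<eta>"
    unfolding pos_divide_le_eq[OF \<open>0 < norm w\<close>] by (rule w)
  finally have "norm (U ((1 / norm w) *\<^sub>R w) - (1 / norm w) *\<^sub>R w) \<le> \<eta>" .
  moreover have "Q ((1 / norm w) *\<^sub>R w) = 0"
    unfolding w_def Q_simps by simp
  moreover have "norm ((1 / norm w) *\<^sub>R w) = 1"
    using \<open>0 < norm w\<close> by simp
  ultimately show ?thesis by blast
qed

section \<open>Ergodic averages\<close>

context ergodic_projection
begin

definition ergodic_error :: "nat \<Rightarrow> 'a \<Rightarrow> 'a"
  where "ergodic_error K \<psi> = ergodic_average U K \<psi> - Q \<psi>"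

lemma bounded_linear_pow: "bounded_linear (U ^^ n)"
proof (induction n)
  case (Suc n)
  show ?case
    using bounded_linear_compose[OF bl_U Suc] by (simp add: o_def)
qed (simp add: id_def bounded_linear_ident)

lemma norm_U_pow [simp]: "norm ((U ^^ n) x) = norm x"
  by (induction n) auto

lemma bounded_linear_ergodic_error: "bounded_linear (ergodic_error K)"
  unfolding ergodic_error_def[abs_def] ergodic_average_def[abs_def]
  by (intro bounded_linear_sub bounded_linear_const_scaleR bounded_linear_sum bounded_linear_pow bl_Q)

lemma continuous_on_ergodic_error: "continuous_on A (\<lambda>\<psi>. norm (ergodic_error K \<psi>))"
  by (intro continuous_on_norm linear_continuous_on bounded_linear_ergodic_error)

text \<open>The coboundary sum telescopes and the fixed part averages to itself. At
  \<open>K = 0\<close> the average is zero, so a fixed part would leave an error.\<close>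

lemma ergodic_error_fixed_plus_coboundary:
  assumes "0 < K"
  shows "ergodic_error K (Q \<psi> + (v - U v)) = (1 / real K) *\<^sub>R (v - (U ^^ K) v)"
proof -
  have fixed: "(U ^^ j) (Q \<psi>) = Q \<psi>" for j
    by (induction j) auto
  have "(\<Sum>j<K. (U ^^ j) (v - U v)) = v - (U ^^ K) v"
  proof (induction K)
    case (Suc K)
    then show ?case
      using linear_diff[OF bounded_linear.linear[OF bounded_linear_pow], of K v "U v"]
      by (simp add: funpow_swap1)
  qed simp
  then have "ergodic_error K (v - U v) = (1 / real K) *\<^sub>R (v - (U ^^ K) v)"
    unfolding ergodic_error_def ergodic_average_def by (simp add: Q_simps)
  moreover have "ergodic_error K (Q \<psi>) = 0"
    using assms unfolding ergodic_error_def ergodic_average_def fixed by (simp add: sum_constant_scaleR)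
  ultimately show ?thesis
    unfolding linear_add[OF bounded_linear.linear[OF bounded_linear_ergodic_error]] by simp
qed

lemma norm_U_pow_diff_le: "norm ((U ^^ j) x - x) \<le> real j * norm (U x - x)"
proof (induction j)
  case (Suc j)
  have "(U ^^ Suc j) x - x = U ((U ^^ j) x - x) + (U x - x)"
    by (simp add: U_simps)
  then have "norm ((U ^^ Suc j) x - x) \<le> norm ((U ^^ j) x - x) + norm (U x - x)"
    by (metis norm_triangle_ineq norm_U)
  with Suc show ?case by (simp add: algebra_simps)
qed simp

text \<open>Over \<open>K\<close> steps the total drift of \<open>x\<close> is at most 1/2, so the
  average stays within 1/2 of the unit vector \<open>x\<close>.\<close>

lemma norm_ergodic_error_ge:
  assumes "0 < K" "norm x = 1" "Q x = 0" and small: "norm (U x - x) \<le> 1 / (2 * real K)"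
  shows "1 / 2 \<le> norm (ergodic_error K x)"
proof -
  have "norm ((U ^^ j) x - x) \<le> 1 / 2" if "j < K" for j
  proof -
    have "real j * norm (U x - x) \<le> real K * (1 / (2 * real K))"
      using that small by (intro mult_mono) auto
    with norm_U_pow_diff_le[of j x] \<open>0 < K\<close> show ?thesis by simp
  qed
  then have "norm (\<Sum>j<K. (U ^^ j) x - x) \<le> real K * (1 / 2)"
    using sum_norm_bound[of "{..<K}" "\<lambda>j. (U ^^ j) x - x" "1 / 2"] by simp
  moreover have "ergodic_error K x - x = (1 / real K) *\<^sub>R (\<Sum>j<K. (U ^^ j) x - x)"
    using assms(1,3)
    by (simp add: ergodic_error_def ergodic_average_def sum_subtractf sum_constant_scaleR
        scaleR_diff_right)
  ultimately have "norm (ergodic_error K x - x) \<le> 1 / 2"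
    using \<open>0 < K\<close> by (simp add: field_simps)
  then show ?thesis
    using norm_triangle_ineq2[of x "ergodic_error K x"] assms(2) by (simp add: norm_minus_commute)
qed

lemma open_ergodic_error_gt: "open {\<psi>. c < a * (norm (ergodic_error K \<psi>))\<^sup>2}"
  and open_ergodic_error_lt: "open {\<psi>. a * (norm (ergodic_error K \<psi>))\<^sup>2 < c}"
  by (intro open_Collect_less continuous_intros continuous_on_ergodic_error)+

lemma dense_fast:
  assumes "0 < \<epsilon>" "0 < c"
  shows "closure (\<Union>K\<in>{N..}. {\<psi>. real K powr (2 - \<epsilon>) * (norm (ergodic_error K \<psi>))\<^sup>2 < c}) = UNIV"
    (is "closure ?D = UNIV")
proof -
  have coboundary: "Q \<psi> + (v - U v) \<in> ?D" for \<psi> v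
  proof -
    \<comment> \<open>The error has norm at most \<open>2 * norm v / K\<close>; its square times
      \<open>K powr (2 - \<epsilon>)\<close> is bounded by this sequence.\<close>
    have "(\<lambda>K. 4 * (norm v)\<^sup>2 * real K powr - \<epsilon>) \<longlonglongrightarrow> 4 * (norm v)\<^sup>2 * 0"
      using assms by (intro tendsto_intros tendsto_neg_powr filterlim_real_sequentially) auto
    then have "\<forall>\<^sub>F K in sequentially. 4 * (norm v)\<^sup>2 * real K powr - \<epsilon> < c"
      using assms by (intro order_tendstoD(2)[where y = "4 * (norm v)\<^sup>2 * 0"]) auto
    \<comment> \<open>\<open>Suc N\<close> rather than \<open>N\<close> also makes \<open>K\<close>
      positive.\<close>
    then have "\<forall>\<^sub>F K in sequentially. 4 * (norm v)\<^sup>2 * real K powr - \<epsilon> < c \<and> Suc N \<le> K"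
      by (intro eventually_conj eventually_ge_at_top)
    then obtain K where K: "4 * (norm v)\<^sup>2 * real K powr - \<epsilon> < c" "Suc N \<le> K"
      by (metis (mono_tags, lifting) eventually_sequentially order_refl)
    have "norm (v - (U ^^ K) v) \<le> 2 * norm v"
      using norm_triangle_ineq4[of v "(U ^^ K) v"] by simp
    then have "norm (ergodic_error K (Q \<psi> + (v - U v))) \<le> 2 * norm v / real K"
      using K(2) by (simp add: ergodic_error_fixed_plus_coboundary divide_right_mono)
    then have bound: "real K powr (2 - \<epsilon>) * (norm (ergodic_error K (Q \<psi> + (v - U v))))\<^sup>2
        \<le> real K powr (2 - \<epsilon>) * (2 * norm v / real K)\<^sup>2"
      by (intro mult_left_mono power_mono) auto
    have powr_split: "real K powr (2 - \<epsilon>) = (real K)\<^sup>2 * real K powr - \<epsilon>"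
      using K(2) powr_add[of "real K" 2 "- \<epsilon>"] by simp
    have cancel: "(real K)\<^sup>2 * real K powr - \<epsilon> * (2 * norm v / real K)\<^sup>2
        = 4 * (norm v)\<^sup>2 * real K powr - \<epsilon>"
      using K(2) by (simp add: power_divide power_mult_distrib)
    have "real K powr (2 - \<epsilon>) * (2 * norm v / real K)\<^sup>2 < c"
      unfolding powr_split cancel by (rule K(1))
    then have "real K powr (2 - \<epsilon>) * (norm (ergodic_error K (Q \<psi> + (v - U v))))\<^sup>2 < c"
      using bound by (rule le_less_trans[rotated])
    then show ?thesis
      using K(2) by (auto intro!: bexI[of _ K])
  qed
  have "\<psi> \<in> closure ?D" for \<psi>
    unfolding closure_approachable
  proof (intro allI impI)
    fix e :: real assume "0 < e"
    then obtain v where "dist (v - U v) (\<psi> - Q \<psi>) < e"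
      using diff_Q_in_closure_coboundaries[of \<psi>] by (auto simp: closure_approachable)
    then have "dist (Q \<psi> + (v - U v)) \<psi> < e"
      by (simp add: dist_norm algebra_simps)
    then show "\<exists>y\<in>?D. dist y \<psi> < e"
      using coboundary by blast
  qed
  then show ?thesis by blast
qed

text \<open>If \<open>x\<close> is nearly fixed, one of \<open>\<psi> \<plusminus> r x\<close> has an error of size at least \<open>r / 2\<close>.\<close>

lemma dense_slow:
  assumes "0 < \<epsilon>" and approx: "\<And>\<eta>. 0 < \<eta> \<Longrightarrow> \<exists>x. norm x = 1 \<and> Q x = 0 \<and> norm (U x - x) \<le> \<eta>"
  shows "closure (\<Union>K\<in>{N..}. {\<psi>. c < real K powr \<epsilon> * (norm (ergodic_error K \<psi>))\<^sup>2}) = UNIV"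
    (is "closure ?D = UNIV")
proof -
  have "\<psi> \<in> closure ?D" for \<psi>
    unfolding closure_approachable
  proof (intro allI impI)
    fix e :: real assume "0 < e"
    define r where "r = e / 2"
    have "0 < r" using \<open>0 < e\<close> by (simp add: r_def)
    have "(\<lambda>K. c * real K powr - \<epsilon>) \<longlonglongrightarrow> c * 0"
      using assms(1) by (intro tendsto_intros tendsto_neg_powr filterlim_real_sequentially) auto
    \<comment> \<open>After multiplication by \<open>K powr \<epsilon>\<close> this says that an
      error of size \<open>r / 2\<close> already exceeds the threshold at time
      \<open>K\<close>.\<close>
    then have "\<forall>\<^sub>F K in sequentially. c * real K powr - \<epsilon> < (r / 2)\<^sup>2"
      using \<open>0 < r\<close> by (intro order_tendstoD(2)[where y = "c * 0"]) auto
    then have "\<forall>\<^sub>F K in sequentially. c * real K powr - \<epsilon> < (r / 2)\<^sup>2 \<and> Suc N \<le> K"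
      by (intro eventually_conj eventually_ge_at_top)
    then obtain K where K: "c * real K powr - \<epsilon> < (r / 2)\<^sup>2" "Suc N \<le> K"
      by (metis (mono_tags, lifting) eventually_sequentially order_refl)
    \<comment> \<open>\<open>x\<close> is chosen after \<open>K\<close>, as its admissible drift
      depends on \<open>K\<close>.\<close>
    obtain x where x: "norm x = 1" "Q x = 0" "norm (U x - x) \<le> 1 / (2 * real K)"
      using approx[of "1 / (2 * real K)"] K(2) by auto
    interpret err: bounded_linear "ergodic_error K"
      by (rule bounded_linear_ergodic_error)
    \<comment> \<open>By linearity the two errors differ by a vector of norm at least
      \<open>r\<close>, so they cannot both be shorter than \<open>r / 2\<close>.\<close>
    have "ergodic_error K (\<psi> + r *\<^sub>R x) - ergodic_error K (\<psi> - r *\<^sub>R x)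
        = (2 * r) *\<^sub>R ergodic_error K x"
      unfolding err.add err.diff err.scaleR mult_2 scaleR_add_left by simp
    then have "norm (ergodic_error K (\<psi> + r *\<^sub>R x) - ergodic_error K (\<psi> - r *\<^sub>R x))
        = 2 * r * norm (ergodic_error K x)"
      using \<open>0 < r\<close> by simp
    moreover have "2 * r * (1 / 2) \<le> 2 * r * norm (ergodic_error K x)"
      using norm_ergodic_error_ge[OF _ x] K(2) \<open>0 < r\<close> by (intro mult_left_mono) auto
    ultimately have "r \<le> norm (ergodic_error K (\<psi> + r *\<^sub>R x) - ergodic_error K (\<psi> - r *\<^sub>R x))"
      by simp
    then have "r / 2 \<le> norm (ergodic_error K (\<psi> + r *\<^sub>R x))
        \<or> r / 2 \<le> norm (ergodic_error K (\<psi> - r *\<^sub>R x))"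
      using norm_triangle_ineq4[of "ergodic_error K (\<psi> + r *\<^sub>R x)" "ergodic_error K (\<psi> - r *\<^sub>R x)"]
      by linarith
    moreover have "dist (\<psi> + r *\<^sub>R x) \<psi> < e" "dist (\<psi> - r *\<^sub>R x) \<psi> < e"
      using x(1) \<open>0 < e\<close> by (simp_all add: dist_norm r_def)
    ultimately obtain y where y: "r / 2 \<le> norm (ergodic_error K y)" "dist y \<psi> < e"
      by blast
    have "c < real K powr \<epsilon> * (r / 2)\<^sup>2"
    proof -
      have "0 < real K powr \<epsilon>" using K(2) by simp
      with K(1) show ?thesis
        unfolding powr_minus_divide by (simp only: times_divide_eq_right mult_1_right pos_divide_less_eq mult.commute)
    qed
    also have "\<dots> \<le> real K powr \<epsilon> * (norm (ergodic_error K y))\<^sup>2"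
      using y(1) \<open>0 < r\<close> by (intro mult_left_mono power_mono) auto
    finally have "y \<in> ?D"
      using K(2) by (auto intro!: bexI[of _ K])
    with y(2) show "\<exists>y\<in>?D. dist y \<psi> < e" by blast
  qed
  then show ?thesis by blast
qed

end

section \<open>Baire category\<close>

lemma gdelta_Inter_open:
  assumes "countable \<G>" "\<G> \<noteq> {}" "\<And>G. G \<in> \<G> \<Longrightarrow> open G"
  shows "gdelta (\<Inter>\<G>)"
proof -
  have "gdelta (\<Inter> (range (from_nat_into \<G>)))"
    using assms by (intro gdelta.intros) (auto intro: from_nat_into)
  then show ?thesis
    using assms by (simp add: range_from_nat_into)
qed

lemma closure_Inter_open_dense:
  fixes \<G> :: "'a::complete_space set set"
  assumes "countable \<G>" "\<And>G. G \<in> \<G> \<Longrightarrow> open G" "\<And>G. G \<in> \<G> \<Longrightarrow> closure G = UNIV"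
  shows "closure (\<Inter>\<G>) = UNIV"
  using Baire_category[of "euclidean :: 'a topology" \<G>] assms
  by (simp add: completely_metrizable_space_euclidean)

section \<open>Upper and lower limits as countably many recurrence conditions\<close>

lemma limsup_ereal_eq_PInfty_iff:
  "limsup (\<lambda>n. ereal (f n)) = \<infinity> \<longleftrightarrow> (\<forall>c::nat. \<exists>\<^sub>F n in sequentially. real c < f n)"
proof
  assume lim: "limsup (\<lambda>n. ereal (f n)) = \<infinity>"
  show "\<forall>c::nat. \<exists>\<^sub>F n in sequentially. real c < f n"
  proof (rule allI, rule ccontr)
    fix c :: nat assume "\<not> (\<exists>\<^sub>F n in sequentially. real c < f n)"
    then have "limsup (\<lambda>n. ereal (f n)) \<le> ereal c"
      by (intro Limsup_bounded) (simp add: not_frequently not_less)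
    with lim show False by simp
  qed
next
  assume freq: "\<forall>c::nat. \<exists>\<^sub>F n in sequentially. real c < f n"
  show "limsup (\<lambda>n. ereal (f n)) = \<infinity>"
  proof (rule ccontr)
    assume "limsup (\<lambda>n. ereal (f n)) \<noteq> \<infinity>"
    then have "limsup (\<lambda>n. ereal (f n)) < \<infinity>"
      by simp
    then obtain r where "limsup (\<lambda>n. ereal (f n)) < ereal r"
      using ereal_dense2 by blast
    moreover obtain c :: nat where "r \<le> real c"
      using real_arch_simple by blast
    ultimately have "limsup (\<lambda>n. ereal (f n)) < ereal (real c)"
      by (meson ereal_less_eq(3) less_le_trans)
    then have "\<forall>\<^sub>F n in sequentially. f n < real c"
      by (auto dest!: Limsup_lessD)
    then have "\<not> (\<exists>\<^sub>F n in sequentially. real c < f n)"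
      by (auto simp: not_frequently elim: eventually_mono)
    with freq show False by blast
  qed
qed

text \<open>Nonnegativity gives one inequality; the other only asks that values below each
  \<open>1 / Suc c\<close> recur.\<close>

lemma liminf_ereal_eq_0_iff:
  assumes nonneg: "\<And>n. 0 \<le> f n"
  shows "liminf (\<lambda>n. ereal (f n)) = 0 \<longleftrightarrow> (\<forall>c::nat. \<exists>\<^sub>F n in sequentially. f n < 1 / real (Suc c))"
proof
  assume lim: "liminf (\<lambda>n. ereal (f n)) = 0"
  show "\<forall>c::nat. \<exists>\<^sub>F n in sequentially. f n < 1 / real (Suc c)"
  proof (rule allI, rule ccontr)
    fix c :: nat assume "\<not> (\<exists>\<^sub>F n in sequentially. f n < 1 / real (Suc c))"
    then have "ereal (1 / real (Suc c)) \<le> liminf (\<lambda>n. ereal (f n))"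
      by (intro Liminf_bounded) (simp add: not_frequently not_less)
    with lim show False by (simp add: zero_ereal_def)
  qed
next
  assume freq: "\<forall>c::nat. \<exists>\<^sub>F n in sequentially. f n < 1 / real (Suc c)"
  have "0 \<le> liminf (\<lambda>n. ereal (f n))"
    using nonneg by (intro Liminf_bounded) (simp add: zero_ereal_def)
  moreover have "\<not> 0 < liminf (\<lambda>n. ereal (f n))"
  proof
    assume "0 < liminf (\<lambda>n. ereal (f n))"
    then obtain r where r: "0 < r" "ereal r < liminf (\<lambda>n. ereal (f n))"
      using ereal_dense2[of 0] by (auto simp: zero_ereal_def)
    obtain c :: nat where "1 / real (Suc c) < r"
      using reals_Archimedean[OF r(1)] unfolding inverse_eq_divide by blast
    moreover have "\<forall>\<^sub>F n in sequentially. r < f n"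
      using less_LiminfD[OF r(2)] by simp
    ultimately have "\<not> (\<exists>\<^sub>F n in sequentially. f n < 1 / real (Suc c))"
      by (auto simp: not_frequently elim: eventually_mono)
    with freq show False by blast
  qed
  ultimately show "liminf (\<lambda>n. ereal (f n)) = 0" by simp
qed


section \<open>Genericity\<close>

text \<open>Both conditions become stronger as \<open>\<epsilon>\<close> decreases, so the values
  \<open>1 / Suc m\<close> suffice. The index \<open>n\<close> sets the threshold, and
  \<open>N\<close> with the union over \<open>K \<ge> N\<close> expresses recurrence.\<close>

lemma slow_fast_set_eq:
  fixes U P
  defines "err K \<psi> \<equiv> (norm (ergodic_average U K \<psi> - P {1} \<psi>))\<^sup>2"
  shows "slow_fast_set U P =
    (\<Inter>(m, n, N). (\<Union>K\<in>{N..}. {\<psi>. real n < real K powr (1 / real (Suc m)) * err K \<psi>})) \<inter>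
    (\<Inter>(m, n, N). (\<Union>K\<in>{N..}. {\<psi>. real K powr (2 - 1 / real (Suc m)) * err K \<psi> < 1 / real (Suc n)}))"
    (is "_ = ?S \<inter> ?F")
proof -
  have err_nonneg: "0 \<le> err K \<psi>" for K \<psi>
    by (simp add: err_def)
  have slow_fast: "\<psi> \<in> slow_fast_set U P \<longleftrightarrow>
      (\<forall>\<epsilon>>0. (\<forall>n::nat. \<exists>\<^sub>F K in sequentially. real n < real K powr \<epsilon> * err K \<psi>) \<and>
        (\<forall>n::nat. \<exists>\<^sub>F K in sequentially. real K powr (2 - \<epsilon>) * err K \<psi> < 1 / real (Suc n)))" for \<psi>
    unfolding slow_fast_set_def err_def[symmetric] mem_Collect_eq limsup_ereal_eq_PInfty_iff
    by (subst liminf_ereal_eq_0_iff) (auto simp: err_nonneg)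
  show ?thesis
  proof (intro equalityI subsetI)
    fix \<psi> assume "\<psi> \<in> slow_fast_set U P"
    then have "(\<exists>\<^sub>F K in sequentially. real n < real K powr (1 / real (Suc m)) * err K \<psi>)"
      "(\<exists>\<^sub>F K in sequentially. real K powr (2 - 1 / real (Suc m)) * err K \<psi> < 1 / real (Suc n))"
      for m n :: nat
      unfolding slow_fast by (auto simp del: of_nat_Suc)
    then show "\<psi> \<in> ?S \<inter> ?F"
      by (auto simp: frequently_sequentially Bex_def)
  next
    fix \<psi> assume "\<psi> \<in> ?S \<inter> ?F"
    then have freq: "(\<exists>\<^sub>F K in sequentially. real n < real K powr (1 / real (Suc m)) * err K \<psi>)"
      "(\<exists>\<^sub>F K in sequentially. real K powr (2 - 1 / real (Suc m)) * err K \<psi> < 1 / real (Suc n))"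
      for m n :: nat
      by (auto simp: frequently_sequentially Bex_def simp del: of_nat_Suc)
    show "\<psi> \<in> slow_fast_set U P"
      unfolding slow_fast
    proof (intro allI impI)
      fix \<epsilon> :: real assume "0 < \<epsilon>"
      then obtain m where m: "1 / real (Suc m) < \<epsilon>"
        using reals_Archimedean[of \<epsilon>] unfolding inverse_eq_divide by blast
      \<comment> \<open>For \<open>K = 0\<close> both sides vanish because
        \<open>0 powr s = 0\<close>; otherwise the base is at least 1.\<close>
      have mono: "real K powr s * err K \<psi> \<le> real K powr t * err K \<psi>" if "s \<le> t" for K s t
        using that err_nonneg by (cases K) (auto intro!: mult_right_mono powr_mono)
      show "(\<forall>n::nat. \<exists>\<^sub>F K in sequentially. real n < real K powr \<epsilon> * err K \<psi>) \<and>
        (\<forall>n::nat. \<exists>\<^sub>F K in sequentially. real K powr (2 - \<epsilon>) * err K \<psi> < 1 / real (Suc n))"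
      proof (intro conjI allI)
        fix n :: nat
        show "\<exists>\<^sub>F K in sequentially. real n < real K powr \<epsilon> * err K \<psi>"
        proof (rule frequently_elim1[OF freq(1)[of n m]])
          fix K assume "real n < real K powr (1 / real (Suc m)) * err K \<psi>"
          also have "\<dots> \<le> real K powr \<epsilon> * err K \<psi>"
            by (rule mono) (use m in linarith)
          finally show "real n < real K powr \<epsilon> * err K \<psi>" .
        qed
        show "\<exists>\<^sub>F K in sequentially. real K powr (2 - \<epsilon>) * err K \<psi> < 1 / real (Suc n)"
        proof (rule frequently_elim1[OF freq(2)[of m n]])
          fix K
          have "real K powr (2 - \<epsilon>) * err K \<psi> \<le> real K powr (2 - 1 / real (Suc m)) * err K \<psi>"
            by (rule mono) (use m in linarith)
          also assume "\<dots> < 1 / real (Suc n)"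
          finally show "real K powr (2 - \<epsilon>) * err K \<psi> < 1 / real (Suc n)" .
        qed
      qed
    qed
  qed
qed

theorem theorem5:
  fixes U :: "'a::complex_hilbert_space \<Rightarrow> 'a"
    and P :: "complex set \<Rightarrow> 'a \<Rightarrow> 'a"
  assumes "separable_space (euclidean :: 'a topology)"
    and "unitary_operator U"
    and "resolution_of_identity U P"
    and "1 islimpt op_spectrum U"
    and "wot_tendsto (\<lambda>j. (U \<circ> P (unit_circle - {1})) ^^ j) (\<lambda>\<psi>. 0)"
  shows "gdelta (slow_fast_set U P) \<and> closure (slow_fast_set U P) = UNIV"
proof -
  have proj: "orthogonal_projection (P {1})"
    using assms(3) by (auto simp: resolution_of_identity_def projection_valued_measure_def)
  note fixed = fixed_iff_spectral_projection_one[OF assms(2,3)]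
  interpret ergodic_projection U "inv U" "P {1}"
    by (rule unitary_operator_ergodic_projection[OF assms(2) proj fixed])
  \<comment> \<open>Merging both families into one countable family lets Baire be applied once;
    density of the two intersections separately would not give density of their
    intersection.\<close>
  define S where "S = (\<lambda>(m, n, N). \<Union>K\<in>{N..}.
    {\<psi>. real n < real K powr (1 / real (Suc m)) * (norm (ergodic_error K \<psi>))\<^sup>2})"
  define F where "F = (\<lambda>(m, n, N). \<Union>K\<in>{N..}.
    {\<psi>. real K powr (2 - 1 / real (Suc m)) * (norm (ergodic_error K \<psi>))\<^sup>2 < 1 / real (Suc n)})"
  have eq: "slow_fast_set U P = \<Inter>(range S \<union> range F)"
    unfolding slow_fast_set_eq S_def F_def ergodic_error_def by auto
  have "countable (range S \<union> range F)"
    by simp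
  moreover have "open G" if "G \<in> range S \<union> range F" for G
    using that by (auto simp: S_def F_def intro!: open_UN open_ergodic_error_gt open_ergodic_error_lt)
  moreover have "closure G = UNIV" if "G \<in> range S \<union> range F" for G
  proof -
    have "closure (S (m, n, N)) = UNIV" "closure (F (m, n, N)) = UNIV" for m n N
      unfolding S_def F_def prod.case
      by (intro dense_slow dense_fast approx_fixed_vector[OF assms(2) proj fixed assms(4)]; simp)+
    with that show ?thesis by auto
  qed
  ultimately show ?thesis
    unfolding eq by (intro conjI gdelta_Inter_open closure_Inter_open_dense) auto
qed

end
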